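(* Let $k>1$ be an integer. The smallest odd positive integer $n$ with $\lambda(n)=k$ is $g(k)$, and the smallest even positive integer $n$ with $\lambda(n)=k$ is $2g(k)$.
   Context: Let $\overline{\psi}$ be the multiplicative arithmetic function with $\overline{\psi}(p^{\alpha})=p^{\alpha-1}(p+1)$ for odd primes $p$ and $\overline{\psi}(2^{\alpha})=2^{\alpha-1}$, for all positive integers $\alpha$ (so $\overline{\psi}(1)=1$). For $n>1$, $\lambda(n)$ is the unique nonnegative integer with $\overline{\psi}^{\lambda(n)}(n)=2$ (where $\overline{\psi}^k$ is the $k$-th iterate, $\overline{\psi}^0(n)=n$), and $\lambda(1)=0$. Define $g(k)$ for integers $k\geq 2$ by $g(k)=5^{k/3}$ if $k\equiv 0\pmod 3$, $g(k)=9\cdot 5^{(k-4)/3}$ if $k\equiv 1\pmod 3$, and $g(k)=3\cdot 5^{(k-2)/3}$ if $k\equiv 2\pmod 3$. *)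

theory Defs
  imports "HOL-Computational_Algebra.Primes"
begin

text \<open>All functions are total on \<^typ>\<open>nat\<close>; they are meant for positive arguments, and their values
  at 0 carry no meaning.\<close>

definition psi_bar_pp :: "nat \<Rightarrow> nat \<Rightarrow> nat" where
  "psi_bar_pp p a = (if p = 2 then 2 ^ (a - 1) else p ^ (a - 1) * (p + 1))"

definition psi_bar :: "nat \<Rightarrow> nat" where
  "psi_bar n = (\<Prod>p\<in>prime_factors n. psi_bar_pp p (multiplicity p n))"

text \<open>The next four facts are the characterization of \<^const>\<open>psi_bar\<close> as the multiplicative function
  with the prescribed values at prime powers.\<close>

lemma psi_bar_1: "psi_bar 1 = 1"
  by (simp add: psi_bar_def)

lemma psi_bar_coprime_mult:
  assumes "coprime m n" "m > 0" "n > 0"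
  shows "psi_bar (m * n) = psi_bar m * psi_bar n"
proof -
  have disj: "prime_factors m \<inter> prime_factors n = {}"
    using assms(1) by (auto simp: in_prime_factors_iff) (metis coprime_common_divisor not_prime_unit)
  have m: "multiplicity p (m * n) = multiplicity p m" if "p \<in> prime_factors m" for p
  proof -
    have "p \<notin> prime_factors n" "prime p" using that disj by auto
    then have "\<not> p dvd n" using assms by (simp add: in_prime_factors_iff)
    then show ?thesis
      using assms \<open>prime p\<close>
      by (simp add: prime_elem_multiplicity_mult_distrib not_dvd_imp_multiplicity_0)
  qed
  have n: "multiplicity p (m * n) = multiplicity p n" if "p \<in> prime_factors n" for p
  proof -
    have "p \<notin> prime_factors m" "prime p" using that disj by auto
    then have "\<not> p dvd m" using assms by (simp add: in_prime_factors_iff)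
    then show ?thesis
      using assms \<open>prime p\<close>
      by (simp add: prime_elem_multiplicity_mult_distrib not_dvd_imp_multiplicity_0)
  qed
  have "prime_factors (m * n) = prime_factors m \<union> prime_factors n"
    using assms by (simp add: prime_factors_product)
  then show ?thesis
    using disj by (simp add: psi_bar_def prod.union_disjoint m n)
qed

lemma psi_bar_odd_prime_power:
  assumes "prime p" "odd p" "a > 0"
  shows "psi_bar (p ^ a) = p ^ (a - 1) * (p + 1)"
  using assms by (auto simp: psi_bar_def psi_bar_pp_def prime_factorization_prime_power)

lemma psi_bar_2_power:
  assumes "a > 0"
  shows "psi_bar (2 ^ a) = 2 ^ (a - 1)"
  using assms by (auto simp: psi_bar_def psi_bar_pp_def prime_factorization_prime_power)

text \<open>For \<open>n > 1\<close> the orbit of \<open>n\<close> meets 2 exactly once, since \<open>psi_bar 2 = 1\<close> and 1 is a fixed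
  point, so the definite description below is then proper.  At 1 there is no such iterate, and the
  value 0 is a convention.\<close>

definition lambda :: "nat \<Rightarrow> nat" where
  "lambda n = (if n = 1 then 0 else (THE k. (psi_bar ^^ k) n = 2))"

text \<open>For \<open>k \<ge> 2\<close> the divisions below are exact and the subtractions do not truncate.\<close>

definition g :: "nat \<Rightarrow> nat" where
  "g k = (if k mod 3 = 0 then 5 ^ (k div 3)
          else if k mod 3 = 1 then 9 * 5 ^ ((k - 4) div 3)
          else 3 * 5 ^ ((k - 2) div 3))"

end

theory Submission
  imports Defs Complex_Main
begin

text \<open>
  Let \<open>F\<close> be the completely additive function with \<open>F 2 = 1\<close> and \<open>F p = F (p + 1)\<close> for odd primes
  \<open>p\<close>. Then \<open>psi_bar\<close> preserves \<open>F\<close> on odd numbers and lowers it by one on even numbers, so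
  \<open>lambda n\<close> is \<open>F n\<close> for odd \<open>n > 1\<close> and \<open>F n - 1\<close> for even \<open>n\<close>. The problem is thus to
  bound \<open>n\<close> from below by \<open>F n\<close>. The ratio \<open>n^3 / 5^(F n)\<close> is completely multiplicative; it is
  \<open>1\<close> at \<open>5\<close>, \<open>27/25\<close> at \<open>3\<close>, and at least \<open>(27/25)^2\<close> at every other prime. As \<open>F 3 = 2\<close> and
  \<open>F 5 = 3\<close>, the residue of \<open>F n\<close> modulo 3 decides how many factors \<open>27/25\<close> are forced.
\<close>

section \<open>The completely additive function \<open>F\<close>\<close>

function F :: "nat \<Rightarrow> nat" where
  "F n = (\<Sum>p\<in>#prime_factorization n. if p = 2 then 1 else Suc (F (Suc p div 2)))"
  by auto
termination
proof (relation "measure id")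
  fix n p :: nat
  assume p: "p \<in># prime_factorization n" "p \<noteq> 2"
  then have "prime p" "p \<le> n"
    by (auto simp: in_prime_factors_iff intro: dvd_imp_le)
  moreover have "p > 2"
    using \<open>prime p\<close> p(2) prime_ge_2_nat[of p] by linarith
  ultimately show "(Suc p div 2, n) \<in> measure id" by auto
qed auto

declare F.simps [simp del]

lemma F_mult: "m > 0 \<Longrightarrow> n > 0 \<Longrightarrow> F (m * n) = F m + F n"
  by (simp add: F.simps[of "m * n"] F.simps[of m] F.simps[of n] prime_factorization_mult)

lemma F_1 [simp]: "F (Suc 0) = 0"
  by (simp add: F.simps)

lemma F_power: "m > 0 \<Longrightarrow> F (m ^ a) = a * F m"
  by (induction a) (auto simp: F_mult)

lemma F_2 [simp]: "F 2 = 1"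
  by (simp add: F.simps[of 2] prime_factorization_prime)

lemma F_odd_prime: "prime p \<Longrightarrow> p \<noteq> 2 \<Longrightarrow> F p = Suc (F (Suc p div 2))"
  by (simp add: F.simps[of p] prime_factorization_prime)

text \<open>The recursion for \<open>F\<close> passes to half of \<open>p + 1\<close> because
  \<open>p + 1\<close> itself is no decrease; additivity restores the factor 2.\<close>

lemma F_Suc_odd_prime:
  assumes "prime p" "p \<noteq> 2"
  shows "F (Suc p) = F p"
proof -
  have "odd p" using assms prime_odd_nat[of p] prime_ge_2_nat[of p] by auto
  then have "Suc p = 2 * (Suc p div 2)" by simp
  moreover have "Suc p div 2 > 0" using prime_ge_2_nat[OF assms(1)] by simp
  ultimately have "F (Suc p) = F 2 + F (Suc p div 2)"
    by (metis F_mult zero_less_numeral)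
  then show ?thesis using F_odd_prime[OF assms] by simp
qed

lemma F_3 [simp]: "F 3 = 2"
proof -
  have "F 3 = Suc (F (2 ^ 1))" by (subst F_odd_prime) auto
  then show ?thesis by simp
qed

lemma F_5 [simp]: "F 5 = 3"
  by (subst F_odd_prime) auto

lemma F_7: "F 7 = 3"
proof -
  have "F 7 = Suc (F (2 ^ 2))" by (subst F_odd_prime) auto
  then show ?thesis by (simp only: F_power) simp
qed

lemma F_prod:
  "finite A \<Longrightarrow> (\<And>x. x \<in> A \<Longrightarrow> f x > 0) \<Longrightarrow> F (\<Prod>x\<in>A. f x) = (\<Sum>x\<in>A. F (f x))"
  by (induction A rule: finite_induct) (auto simp: F_mult prod_pos)

text \<open>One prime factor already contributes at least 1, so among positive numbers
  \<open>F\<close> vanishes only at 1.\<close>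

lemma F_pos:
  assumes "n > 1"
  shows "F n > 0"
proof -
  obtain p where p: "prime p" "p dvd n" using assms prime_factor_nat[of n] by auto
  then obtain m where m: "n = p * m" by blast
  have "m > 0" using m assms by (cases m) auto
  then have "F n = F p + F m" using m p by (simp add: F_mult prime_gt_0_nat)
  moreover have "F p > 0" using p by (cases "p = 2") (auto simp: F_odd_prime)
  ultimately show ?thesis by simp
qed

section \<open>Effect of \<open>psi_bar\<close> on \<open>F\<close> and on parity\<close>

lemma psi_bar_pos: "psi_bar n > 0"
  unfolding psi_bar_def
  by (rule prod_pos) (auto simp: psi_bar_pp_def in_prime_factors_iff prime_gt_0_nat)

text \<open>In each prime power one factor \<open>p\<close> is traded for \<open>p + 1\<close>,
  which has the same \<open>F\<close>.\<close>

lemma F_psi_bar_odd: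
  assumes "odd n"
  shows "F (psi_bar n) = F n"
proof -
  have n: "n > 0" using assms by (cases n) auto
  have "F (psi_bar_pp p (multiplicity p n)) = F (p ^ multiplicity p n)"
    if "p \<in> prime_factors n" for p
  proof -
    have p: "prime p" "p dvd n" "p \<noteq> 2" using that assms by (auto simp: in_prime_factors_iff)
    then have "multiplicity p n > 0" using that by (simp add: prime_factors_multiplicity)
    then obtain a where "multiplicity p n = Suc a" by (cases "multiplicity p n") auto
    moreover have "F (p ^ a * Suc p) = F (p ^ Suc a)"
      using p F_Suc_odd_prime[of p]
      by (simp only: F_mult F_power prime_gt_0_nat zero_less_power zero_less_Suc) simp
    ultimately show ?thesis using p by (simp add: psi_bar_pp_def)
  qed
  then have "F (psi_bar n) = (\<Sum>p\<in>prime_factors n. F (p ^ multiplicity p n))"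
    unfolding psi_bar_def
    by (subst F_prod) (auto simp: psi_bar_pp_def in_prime_factors_iff prime_gt_0_nat)
  also have "\<dots> = F (\<Prod>p\<in>prime_factors n. p ^ multiplicity p n)"
    by (subst F_prod) (auto simp: in_prime_factors_iff prime_gt_0_nat)
  also have "\<dots> = F n" using n by (simp add: prime_factorization_nat[symmetric])
  finally show ?thesis .
qed

text \<open>Any prime divisor \<open>p\<close> is odd and contributes the even factor
  \<open>p + 1\<close>.\<close>

lemma even_psi_bar_odd:
  assumes "odd n" "n > 1"
  shows "even (psi_bar n)"
proof -
  obtain p where p: "prime p" "p dvd n" using assms prime_factor_nat[of n] by auto
  then have "p \<in> prime_factors n" using assms by (simp add: in_prime_factors_iff)
  then have "psi_bar_pp p (multiplicity p n) dvd psi_bar n"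
    unfolding psi_bar_def by (intro dvd_prodI) auto
  moreover have "odd p" using p assms dvd_trans by blast
  then have "even (psi_bar_pp p (multiplicity p n))" by (auto simp: psi_bar_pp_def)
  ultimately show ?thesis using dvd_trans by blast
qed

lemma psi_bar_even:
  assumes "odd m"
  shows "psi_bar (2 ^ Suc a * m) = 2 ^ a * psi_bar m"
proof -
  have "coprime (2 ^ Suc a) m" using assms by (simp del: power_Suc)
  then have "psi_bar (2 ^ Suc a * m) = psi_bar (2 ^ Suc a) * psi_bar m"
    using assms by (intro psi_bar_coprime_mult) (auto simp: odd_pos simp del: power_Suc)
  then show ?thesis using psi_bar_2_power[of "Suc a"] by simp
qed

lemma even_decomp:
  fixes n :: nat
  assumes "even n" "n > 0"
  obtains a m where "n = 2 ^ Suc a * m" "odd m"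
proof -
  obtain m where m: "n = 2 ^ multiplicity 2 n * m" "\<not> 2 dvd m"
    using assms multiplicity_decompose'[of n 2] by auto
  moreover have "multiplicity 2 n \<noteq> 0" using assms m by (metis mult_1 power_0)
  ultimately show ?thesis using that by (metis not0_implies_Suc)
qed

lemma F_psi_bar_even:
  assumes "even n" "n > 0"
  shows "Suc (F (psi_bar n)) = F n"
  using even_decomp[OF assms]
proof cases
  case (1 a m)
  then show ?thesis
    by (simp add: psi_bar_even F_mult F_power F_psi_bar_odd psi_bar_pos odd_pos del: power_Suc)
qed

text \<open>If 4 divides \<open>n\<close>, a factor 2 survives; otherwise the odd part exceeds 1 and
  supplies a new one. So orbits stay even until they reach 2.\<close>

lemma even_psi_bar_even:
  assumes "even n" "n > 2"
  shows "even (psi_bar n)"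
proof -
  obtain a m where m: "n = 2 ^ Suc a * m" "odd m"
    using assms by (auto elim: even_decomp)
  show ?thesis
  proof (cases a)
    case 0
    then have "m > 1" using m assms by simp
    then show ?thesis using m even_psi_bar_odd by (simp add: psi_bar_even del: power_Suc)
  next
    case (Suc b)
    then show ?thesis using m psi_bar_even[OF m(2), of a] by simp
  qed
qed

section \<open>Iteration of \<open>psi_bar\<close> and the value of \<open>lambda\<close>\<close>

lemma psi_bar_iter_even:
  "even n \<Longrightarrow> n > 0 \<Longrightarrow> F n = Suc j \<Longrightarrow> (psi_bar ^^ j) n = 2"
proof (induction j arbitrary: n)
  case 0
  then obtain m where m: "n = 2 * m" "m > 0" by auto
  then have "F m = 0" using 0 by (simp add: F_mult)
  then show ?case using m F_pos[of m] by (cases "m > 1") auto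
next
  case (Suc j)
  have "n \<noteq> 2" using Suc.prems(3) F_2 by force
  then have "n > 2" using Suc.prems by (cases "n = 1") auto
  then have "even (psi_bar n)" using even_psi_bar_even Suc.prems by blast
  moreover have "F (psi_bar n) = Suc j" using F_psi_bar_even[of n] Suc.prems by simp
  ultimately have "(psi_bar ^^ j) (psi_bar n) = 2" using Suc.IH psi_bar_pos by blast
  then show ?case by (simp add: funpow_Suc_right del: funpow.simps)
qed

lemma psi_bar_iter_after_2: "(psi_bar ^^ Suc j) 2 = 1"
proof (induction j)
  case 0
  show ?case using psi_bar_2_power[of 1] by simp
next
  case (Suc j)
  then show ?case using psi_bar_1 by simp
qed

text \<open>Two visits to 2 would make 2 recur in its own orbit, which is 1 from the first step
  on.\<close>

lemma psi_bar_iter_unique: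
  assumes "(psi_bar ^^ i) n = 2" "(psi_bar ^^ j) n = 2"
  shows "i = j"
proof -
  have False if "(psi_bar ^^ i) n = 2" "(psi_bar ^^ j) n = 2" "i < j" for i j
  proof -
    obtain d where "j = Suc d + i"
      using \<open>i < j\<close> less_imp_Suc_add[of i j] by (metis add.commute add_Suc_right)
    then have "(psi_bar ^^ Suc d) 2 = 2" using that by (metis comp_apply funpow_add)
    then show False using psi_bar_iter_after_2[of d] by simp
  qed
  then show ?thesis using assms by (meson linorder_neqE_nat)
qed

lemma lambda_eqI: "n \<noteq> 1 \<Longrightarrow> (psi_bar ^^ j) n = 2 \<Longrightarrow> lambda n = j"
  unfolding lambda_def using psi_bar_iter_unique by (auto intro!: the_equality)

text \<open>The offset arises because the orbit is stopped at 2, where \<open>F\<close> is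
  1.\<close>

lemma lambda_even:
  assumes "even n" "n > 0"
  shows "Suc (lambda n) = F n"
proof -
  have "n > 1" using assms by (cases "n = 1") auto
  then obtain j where "F n = Suc j" using F_pos[of n] by (cases "F n") auto
  then show ?thesis using psi_bar_iter_even[OF assms] assms lambda_eqI[of n j] by auto
qed

text \<open>The first step reaches an even number at no cost in \<open>F\<close>; this extra step
  cancels the offset of the even case.\<close>

lemma lambda_odd:
  assumes "odd n" "n > 1"
  shows "lambda n = F n"
proof -
  obtain j where j: "F n = Suc j" using F_pos[of n] assms by (cases "F n") auto
  then have "(psi_bar ^^ j) (psi_bar n) = 2"
    using assms by (intro psi_bar_iter_even even_psi_bar_odd psi_bar_pos) (auto simp: F_psi_bar_odd)
  then have "(psi_bar ^^ Suc j) n = 2" by (simp add: funpow_Suc_right del: funpow.simps)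
  then show ?thesis using j assms lambda_eqI[of n "Suc j"] by auto
qed

section \<open>The lower bound for \<open>n\<close> in terms of \<open>F n\<close>\<close>

text \<open>Equals \<open>(g k)^3 / 5^k\<close> for \<open>k \<ge> 2\<close>.\<close>

definition thr :: "nat \<Rightarrow> real" where
  "thr k = (if k mod 3 = 0 then 1 else if k mod 3 = 1 then 729 / 625 else 27 / 25)"

lemma thr_ge_1: "thr k \<ge> 1" and thr_le: "thr k \<le> 729 / 625"
  by (auto simp: thr_def)

text \<open>With \<open>t = 27/25\<close>, \<open>thr k\<close> is \<open>t ^ (2 * k mod 3)\<close>;
  residues are subadditive and \<open>t > 1\<close>.\<close>

lemma thr_add: "thr (a + b) \<le> thr a * thr b"
proof -
  have "a mod 3 = 0 \<or> a mod 3 = 1 \<or> a mod 3 = 2" "b mod 3 = 0 \<or> b mod 3 = 1 \<or> b mod 3 = 2"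
    by presburger+
  then show ?thesis by (auto simp: thr_def mod_add_eq[of a 3 b, symmetric])
qed

text \<open>The bound at \<open>(p + 1) / 2\<close> is used without its factor \<open>thr\<close>,
  and \<open>thr (F p)\<close> is replaced by its maximum. From 9 on this loss is affordable;
  smaller primes are computed.\<close>

lemma thr_F_prime:
  assumes p: "prime p" and IH: "5 ^ F (Suc p div 2) \<le> real (Suc p div 2) ^ 3"
  shows "thr (F p) * 5 ^ F p \<le> real p ^ 3"
proof -
  consider "p = 2" | "p = 3" | "p = 5" | "p = 7" | "p \<ge> 9"
  proof -
    have "p \<noteq> 4" "p \<noteq> 6" "p \<noteq> 8" using p by auto
    moreover have "p \<ge> 2" using p by (rule prime_ge_2_nat)
    ultimately show ?thesis using that by linarith
  qed
  then show ?thesis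
  proof cases
    case 5
    then have "odd p" using p prime_odd_nat[of p] by auto
    then have half: "real (Suc p div 2) = (real p + 1) / 2"
      by (auto elim!: oddE)
    have "thr (F p) * 5 ^ F p \<le> 729 / 625 * 5 ^ F p"
      using thr_le by (intro mult_right_mono) auto
    also have "\<dots> = 729 / 125 * 5 ^ F (Suc p div 2)"
      using F_odd_prime[OF p] 5 by simp
    also have "\<dots> \<le> 729 / 125 * ((real p + 1) / 2) ^ 3"
      using IH half by simp
    \<comment> \<open>\<open>729 / 125\<close> is the cube of \<open>9 / 5\<close>. The cutoff is 9
      because \<open>9 / 10 * (p + 1) \<le> p\<close> means \<open>p \<ge> 9\<close>.\<close>
    also have "\<dots> = (9 / 10 * (real p + 1)) ^ 3"
      by (simp only: power_mult_distrib power_divide) simp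
    also have "\<dots> \<le> real p ^ 3"
      using 5 by (intro power_mono) auto
    finally show ?thesis .
  qed (simp_all add: thr_def F_7)
qed

text \<open>Composite numbers follow from \<open>thr_add\<close>, odd primes from the smaller number
  \<open>(n + 1) / 2\<close>.\<close>

lemma thr_F_le: "n > 0 \<Longrightarrow> thr (F n) * 5 ^ F n \<le> real n ^ 3"
proof (induction n rule: less_induct)
  case (less n)
  consider "n = 1" | "prime n" | a b where "n = a * b" "a < n" "b < n"
  proof (cases "n = 1 \<or> prime n")
    case False
    then obtain a where a: "a dvd n" "a \<noteq> 1" "a \<noteq> n"
      using less.prems prime_nat_iff[of n] by auto
    then obtain b where b: "n = a * b" by blast
    then have "a \<noteq> 0" "b \<noteq> 0" "b \<noteq> 1" using less.prems a by auto
    then have "a < n" "b < n" using a b by auto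
    then show ?thesis using that b by blast
  qed (use that in blast)
  then show ?case
  proof cases
    case 1
    then show ?thesis by (simp add: thr_def)
  next
    case 2
    show ?thesis
    proof (cases "n = 2")
      case False
      then have "n > 2" using prime_ge_2_nat[OF 2] by simp
      then have "thr (F (Suc n div 2)) * 5 ^ F (Suc n div 2) \<le> real (Suc n div 2) ^ 3"
        by (intro less.IH) auto
      moreover have "1 * 5 ^ F (Suc n div 2) \<le> thr (F (Suc n div 2)) * 5 ^ F (Suc n div 2)"
        using thr_ge_1 by (intro mult_right_mono) auto
      ultimately show ?thesis using thr_F_prime[OF 2] by linarith
    qed (simp add: thr_def)
  next
    case 3
    then have pos: "a > 0" "b > 0" using less.prems by auto
    have "thr (F n) * 5 ^ F n \<le> (thr (F a) * thr (F b)) * 5 ^ F n"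
      using 3 pos by (intro mult_right_mono) (auto simp: F_mult thr_add)
    also have "\<dots> = (thr (F a) * 5 ^ F a) * (thr (F b) * 5 ^ F b)"
      using 3 pos by (simp add: F_mult power_add)
    also have "\<dots> \<le> real a ^ 3 * real b ^ 3"
      using 3 pos thr_ge_1[of "F b"] by (intro mult_mono less.IH) auto
    finally show ?thesis using 3 by (simp add: power_mult_distrib)
  qed
qed

section \<open>The extremal numbers \<open>g k\<close>\<close>

lemma g_cases:
  assumes "k > 1"
  obtains q where "k = 3 * q" "g k = 5 ^ q"
    | q where "k = 3 * q + 4" "g k = 9 * 5 ^ q"
    | q where "k = 3 * q + 2" "g k = 3 * 5 ^ q"
proof -
  consider "k mod 3 = 0" | "k mod 3 = 1" | "k mod 3 = 2" by linarith
  then show ?thesis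
  proof cases
    case 1
    then show ?thesis using that(1)[of "k div 3"] by (auto simp: g_def)
  next
    case 2
    \<comment> \<open>Since \<open>k > 1\<close>, this residue forces \<open>k \<ge> 4\<close>, so
      \<open>k - 4\<close> does not truncate.\<close>
    then have "k = 3 * ((k - 4) div 3) + 4" using assms by presburger
    then show ?thesis using that(2)[of "(k - 4) div 3"] 2 by (auto simp: g_def)
  next
    case 3
    then have "k = 3 * ((k - 2) div 3) + 2" by presburger
    then show ?thesis using that(3)[of "(k - 2) div 3"] 3 by (auto simp: g_def)
  qed
qed

lemma F_9: "F 9 = 4"
  using F_mult[of 3 3] by simp

lemma F_g: "k > 1 \<Longrightarrow> F (g k) = k"
  by (erule g_cases) (simp_all add: F_mult F_power F_9)

text \<open>Together with \<open>F_g\<close>, this says that \<open>g k\<close> attains equality in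
  \<open>thr_F_le\<close>.\<close>

lemma g_cube:
  assumes "k > 1"
  shows "real (g k) ^ 3 = thr k * 5 ^ k"
proof -
  have cube: "((5::real) ^ q) ^ 3 = 125 ^ q" for q
    by (simp flip: power_mult_distrib add: power3_eq_cube)
  show ?thesis
    using assms
  proof (cases rule: g_cases)
    case (2 q)
    then have "k mod 3 = 1" by presburger
    then show ?thesis using 2 by (simp add: thr_def power_mult_distrib power_add power_mult cube)
  next
    case (3 q)
    then have "k mod 3 = 2" by presburger
    then show ?thesis using 3 by (simp add: thr_def power_mult_distrib power_add power_mult cube)
  qed (simp add: thr_def power_mult cube)
qed

text \<open>No parity is assumed, so this serves odd numbers and halves of even numbers
  alike.\<close>

lemma g_F_le:
  assumes "n > 0" "F n > 1"
  shows "g (F n) \<le> n"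
proof -
  have "real (g (F n)) ^ 3 \<le> real n ^ 3"
    using assms thr_F_le g_cube by simp
  then show ?thesis by simp
qed

lemma odd_g: "k > 1 \<Longrightarrow> odd (g k)"
  by (erule g_cases) auto

theorem theorem2p1:
  fixes k :: nat
  assumes "k > 1"
  shows "(g k > 0 \<and> odd (g k) \<and> lambda (g k) = k \<and>
            (\<forall>n::nat. n > 0 \<and> odd n \<and> lambda n = k \<longrightarrow> g k \<le> n)) \<and>
         (2 * g k > 0 \<and> even (2 * g k) \<and> lambda (2 * g k) = k \<and>
            (\<forall>n::nat. n > 0 \<and> even n \<and> lambda n = k \<longrightarrow> 2 * g k \<le> n))"
proof -
  have odd: "odd (g k)" and F: "F (g k) = k" using assms odd_g F_g by auto
  have pos: "g k > 0" using odd by (rule odd_pos)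
  have "g k \<noteq> 1" using F assms by auto
  then have "lambda (g k) = k" using lambda_odd[OF odd] pos F by simp
  moreover have "lambda (2 * g k) = k" using lambda_even[of "2 * g k"] pos F by (simp add: F_mult)
  moreover have "g k \<le> n" if "n > 0" "odd n" "lambda n = k" for n
  proof -
    \<comment> \<open>The conventional value \<open>lambda 1 = 0\<close> differs from
      \<open>k\<close>.\<close>
    have "n \<noteq> 1" using that assms by (auto simp: lambda_def)
    then have "F n = k" using that lambda_odd[of n] by simp
    then show ?thesis using g_F_le that assms by blast
  qed
  moreover have "2 * g k \<le> n" if n: "n > 0" "even n" "lambda n = k" for n
  proof -
    obtain m where m: "n = 2 * m" using n by blast
    \<comment> \<open>Halving lowers \<open>F\<close> by 1, which cancels the offset in
      \<open>lambda_even\<close>.\<close>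
    then have "F m = k" using n lambda_even[of n] by (simp add: F_mult)
    then show ?thesis using g_F_le[of m] m n assms by simp
  qed
  ultimately show ?thesis using odd pos by simp
qed

end
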